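(* Let $\mathcal{D}^F=(\mathcal{N},\mathcal{A},\nu,l)$ be a decision diagram encoding $\{x\in\{0,1\}^n:A^Fx\le b^F\}$ with objective $\sum_{j=1}^n c^F_jx_j$, with $l_a=c^F_{\tau_a}$ if $\nu_a=1$ and $l_a=0$ otherwise, and let $x^L\in\{0,1\}^n$ be a given leader solution. Consider the following system in $(x^F,y,\pi,\gamma)$: $$\sum_{a\in\Gamma^+(\mathbf{r})}y_a=1;\qquad \sum_{a\in\Gamma^+(u)}y_a-\sum_{a\in\Gamma^-(u)}y_a=0\ \ \forall u\in\mathcal{N}\setminus\{\mathbf{r},\mathbf{t}\};\qquad y_a\le 1-x^L_{\tau_a}\ \ \forall a\in\mathcal{A}:\nu_a=1;$$ $$\pi_{t_a}-\pi_{h_a}+\gamma_a\ge l_a\ \ \forall a\in\mathcal{A}:\nu_a=1;\qquad \pi_{t_a}-\pi_{h_a}\ge 0\ \ \forall a\in\mathcal{A}:\nu_a=0;$$ $$l^\top y-\pi_{\mathbf{r}}-\sum_{a\in\mathcal{A}:\nu_a=1}\gamma_a(1-x^L_{\tau_a})=0;\qquad x^F_j-\sum_{a\in\mathcal{A}:\,t_a\in\mathcal{N}_j,\ \nu_a=1}y_a=0\ \ \forall j\in\{1,\dots,n\};$$ $$x^F\in\{0,1\}^n,\quad y\in\{0,1\}^{|\mathcal{A}|},\quad \gamma\ge 0.$$ Any feasible solution $(\hat{x}^F,\hat{y},\hat{\pi},\hat{\gamma})$ to this system can be modified to satisfy $\hat{\gamma}_a=M_a$ for all arcs $a\in\mathcal{A}$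 such that $x^L_{\tau_a}=1$ and $\nu_a=1$, preserving feasibility, where the $M_a$ values are large constants that satisfy $$M_a\ge l_a+\hat{\pi}_{h_a}-\hat{\pi}_{t_a}\qquad\forall a\in\mathcal{A}:\ x^L_{\tau_a}=1\text{ and }\nu_a=1.$$
   Context: A decision diagram $\mathcal{D}=(\mathcal{N},\mathcal{A},\nu,l)$ with $n\ge 1$ variables is a finite acyclic directed graph (parallel arcs allowed) with node set partitioned into layers $\mathcal{N}_1,\dots,\mathcal{N}_{n+1}$, $\mathcal{N}_1=\{\mathbf{r}\}$, $\mathcal{N}_{n+1}=\{\mathbf{t}\}$. Each arc $a$ goes from a tail node $t_a$ in some layer $\mathcal{N}_j$ to a head node $h_a\in\mathcal{N}_{j+1}$; $\tau_a:=j$ denotes the layer of its tail. Arc $a$ has a value $\nu_a$ (here in $\{0,1\}$) and a length $l_a\in\mathbb{R}$. $\Gamma^+(u)$, $\Gamma^-(u)$ are the sets of arcs leaving and entering $u$. The diagram encodes a finite set $\mathcal{X}$ with objective $f$ if $(a_1,\dots,a_n)\mapsto(\nu_{a_1},\dots,\nu_{a_n})$ is a one-to-one correspondence between $\mathbf{r}$-$\mathbf{t}$ paths and $\mathcal{X}$ and path lengths equal $f$ of the corresponding solutions. In the system, $\pi$ is a real vector indexed by the nodes, and $y$ and $\gamma$ are indexed by arcs (only the entries $\gamma_a$ with $\nu_a=1$ appear). $A^F,b^F,c^F$ are real data of appropriate dimensions. In the underlying two-stage problem, $x^L$ is the leader's decision and the follower, for fixed $x^L$, maximizes $\sum_j c_j^F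 x_j$ over $x\in\{0,1\}^n$ with $A^Fx\le b^F$ and $x\le \mathbf{1}-x^L$; the system expresses primal feasibility, dual feasibility and strong duality for the path formulation of the follower's problem over $\mathcal{D}^F$.
   Formalization: The large constants M_a are also assumed nonnegative: the displayed bound alone allows a negative M_a (when l_a + π_{h_a} − π_{t_a} < 0), and then γ_a = M_a would violate γ ≥ 0. *)

theory Defs
  imports "Graph_Theory.Arc_Walk" "Jordan_Normal_Form.Matrix"
begin

text \<open>
  Layers and vector coordinates are both counted from 0, so that an arc whose tail lies in
  layer \<open>j\<close> decides coordinate \<open>j\<close>: the layers
  \<open>N\<^sub>1, \<dots>, N\<^sub>n\<^sub>+\<^sub>1\<close> are the levels \<open>0, \<dots>, n\<close> of \<open>layer\<close>,
  and the variables \<open>1, \<dots>, n\<close> are the coordinates \<open>0, \<dots>, n - 1\<close>.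
\<close>

record ('v, 'a) diagram =
  dd_graph :: "('v, 'a) pre_digraph"
  num_vars :: nat
  layer :: "'v \<Rightarrow> nat"
  root :: 'v
  terminal :: 'v
  arc_val :: "'a \<Rightarrow> real"
  arc_len :: "'a \<Rightarrow> real"

abbreviation nodes :: "('v, 'a) diagram \<Rightarrow> 'v set" where
  "nodes D \<equiv> verts (dd_graph D)"

abbreviation dd_arcs :: "('v, 'a) diagram \<Rightarrow> 'a set" where
  "dd_arcs D \<equiv> arcs (dd_graph D)"

abbreviation arc_tail :: "('v, 'a) diagram \<Rightarrow> 'a \<Rightarrow> 'v" where
  "arc_tail D \<equiv> tail (dd_graph D)"

abbreviation arc_head :: "('v, 'a) diagram \<Rightarrow> 'a \<Rightarrow> 'v" where
  "arc_head D \<equiv> head (dd_graph D)"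

definition tail_layer :: "('v, 'a) diagram \<Rightarrow> 'a \<Rightarrow> nat" where
  "tail_layer D a = layer D (arc_tail D a)"

text \<open>Acyclicity is not listed because it follows from \<open>arc_layers\<close>.\<close>

locale decision_diagram = fin_digraph "dd_graph D"
  for D :: "('v, 'a) diagram" +
  assumes num_vars_pos: "num_vars D \<ge> 1"
    and layer_le: "u \<in> nodes D \<Longrightarrow> layer D u \<le> num_vars D"
    and root_layer: "{u \<in> nodes D. layer D u = 0} = {root D}"
    and terminal_layer: "{u \<in> nodes D. layer D u = num_vars D} = {terminal D}"
    and arc_layers: "a \<in> dd_arcs D \<Longrightarrow> layer D (arc_head D a) = Suc (layer D (arc_tail D a))"
    and arc_val_binary: "a \<in> dd_arcs D \<Longrightarrow> arc_val D a \<in> {0, 1}"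

definition root_terminal_paths :: "('v, 'a) diagram \<Rightarrow> 'a list set" where
  "root_terminal_paths D = {p. pre_digraph.apath (dd_graph D) (root D) p (terminal D)}"

definition path_solution :: "('v, 'a) diagram \<Rightarrow> 'a list \<Rightarrow> real vec" where
  "path_solution D p = vec_of_list (map (arc_val D) p)"

definition path_length :: "('v, 'a) diagram \<Rightarrow> 'a list \<Rightarrow> real" where
  "path_length D p = (\<Sum>a\<leftarrow>p. arc_len D a)"

definition encodes :: "('v, 'a) diagram \<Rightarrow> real vec set \<Rightarrow> (real vec \<Rightarrow> real) \<Rightarrow> bool" where
  "encodes D X f \<longleftrightarrow>
     finite X \<and>
     bij_betw (path_solution D) (root_terminal_paths D) X \<and>
     (\<forall>p \<in> root_terminal_paths D. path_length D p = f (path_solution D p))"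

definition binary_vecs :: "nat \<Rightarrow> real vec set" where
  "binary_vecs n = {x \<in> carrier_vec n. \<forall>j < n. x $ j \<in> {0, 1}}"

definition follower_set :: "nat \<Rightarrow> real mat \<Rightarrow> real vec \<Rightarrow> real vec set" where
  "follower_set n A b = {x \<in> binary_vecs n. A *\<^sub>v x \<le> b}"

text \<open>
  The values of \<open>\<gamma>\<close> at arcs of value 0 and of \<open>y\<close>, \<open>\<gamma>\<close>, \<open>\<pi>\<close> outside the
  diagram are irrelevant: they do not occur in the system.
\<close>

definition follower_system ::
  "('v, 'a) diagram \<Rightarrow> real vec \<Rightarrow>
    real vec \<Rightarrow> ('a \<Rightarrow> real) \<Rightarrow> ('v \<Rightarrow> real) \<Rightarrow> ('a \<Rightarrow> real) \<Rightarrow> bool" where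
  "follower_system D xL xF y \<pi> \<gamma> \<longleftrightarrow>
     (\<Sum>a \<in> out_arcs (dd_graph D) (root D). y a) = 1 \<and>
     (\<forall>u \<in> nodes D - {root D, terminal D}.
        (\<Sum>a \<in> out_arcs (dd_graph D) u. y a) - (\<Sum>a \<in> in_arcs (dd_graph D) u. y a) = 0) \<and>
     (\<forall>a \<in> dd_arcs D. arc_val D a = 1 \<longrightarrow> y a \<le> 1 - xL $ tail_layer D a) \<and>
     (\<forall>a \<in> dd_arcs D. arc_val D a = 1 \<longrightarrow>
        \<pi> (arc_tail D a) - \<pi> (arc_head D a) + \<gamma> a \<ge> arc_len D a) \<and>
     (\<forall>a \<in> dd_arcs D. arc_val D a = 0 \<longrightarrow> \<pi> (arc_tail D a) - \<pi> (arc_head D a) \<ge> 0) \<and>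
     (\<Sum>a \<in> dd_arcs D. arc_len D a * y a) - \<pi> (root D)
        - (\<Sum>a \<in> {a \<in> dd_arcs D. arc_val D a = 1}. \<gamma> a * (1 - xL $ tail_layer D a)) = 0 \<and>
     (\<forall>j < num_vars D.
        xF $ j - (\<Sum>a \<in> {a \<in> dd_arcs D. tail_layer D a = j \<and> arc_val D a = 1}. y a) = 0) \<and>
     xF \<in> binary_vecs (num_vars D) \<and>
     (\<forall>a \<in> dd_arcs D. y a \<in> {0, 1}) \<and>
     (\<forall>a \<in> dd_arcs D. arc_val D a = 1 \<longrightarrow> \<gamma> a \<ge> 0)"

end

theory Submission
  imports Defs
begin

text \<open>
  The multiplier \<open>\<gamma> a\<close> occurs in three places of the system: in the strong duality equation,
  where its coefficient is \<open>1 - xL $ tail_layer D a\<close>, in the dual constraint of the arc \<open>a\<close>, and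
  in its sign constraint. If the leader takes the variable decided by \<open>a\<close>, the coefficient vanishes,
  so \<open>\<gamma> a\<close> costs nothing in the dual objective and is bounded only from below, by \<open>0\<close> and
  by the reduced length \<open>arc_len D a + \<pi> (arc_head D a) - \<pi> (arc_tail D a)\<close>. Every value above
  these bounds is therefore as good as the given one. Lemma \<open>follower_system_change_multipliers\<close>
  is this argument for an arbitrary change of multipliers on such arcs.
\<close>

text \<open>
  The objective value of the dual solution is the same for \<open>\<gamma>\<close> and \<open>\<gamma>'\<close>, since they
  differ only where the coefficient is zero; what remains to be assumed of \<open>\<gamma>'\<close> is dual
  feasibility on the changed arcs.
\<close>

lemma follower_system_change_multipliers:
  assumes sys: "follower_system D xL xF y \<pi> \<gamma>"
    and changed: "\<And>a. a \<in> dd_arcs D \<Longrightarrow> arc_val D a = 1 \<Longrightarrow> \<gamma>' a \<noteq> \<gamma> a \<Longrightarrow>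
      xL $ tail_layer D a = 1 \<and> \<gamma>' a \<ge> 0 \<and>
      \<gamma>' a \<ge> arc_len D a + \<pi> (arc_head D a) - \<pi> (arc_tail D a)"
  shows "follower_system D xL xF y \<pi> \<gamma>'"
proof -
  have cost: "(\<Sum>a \<in> {a \<in> dd_arcs D. arc_val D a = 1}. \<gamma>' a * (1 - xL $ tail_layer D a)) =
      (\<Sum>a \<in> {a \<in> dd_arcs D. arc_val D a = 1}. \<gamma> a * (1 - xL $ tail_layer D a))"
  proof (rule sum.cong)
    fix a assume "a \<in> {a \<in> dd_arcs D. arc_val D a = 1}"
    then show "\<gamma>' a * (1 - xL $ tail_layer D a) = \<gamma> a * (1 - xL $ tail_layer D a)"
      using changed[of a] by (cases "\<gamma>' a = \<gamma> a") auto
  qed simp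
  have dual: "\<pi> (arc_tail D a) - \<pi> (arc_head D a) + \<gamma>' a \<ge> arc_len D a \<and> \<gamma>' a \<ge> 0"
    if "a \<in> dd_arcs D" and "arc_val D a = 1" for a
  proof (cases "\<gamma>' a = \<gamma> a")
    case True
    then show ?thesis using sys that unfolding follower_system_def by simp
  next
    case False
    then show ?thesis using changed[of a] that by simp
  qed
  show ?thesis
    using sys dual unfolding follower_system_def cost by blast
qed

theorem proposition5:
  fixes D :: "('v, 'a) diagram"
    and n m :: nat
    and A :: "real mat" and b c :: "real vec"
    and xL xF :: "real vec"
    and y \<gamma> M :: "'a \<Rightarrow> real" and \<pi> :: "'v \<Rightarrow> real"
  assumes "decision_diagram D" and "num_vars D = n"
    and "A \<in> carrier_mat m n" and "b \<in> carrier_vec m" and "c \<in> carrier_vec n"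
    and "encodes D (follower_set n A b) (\<lambda>x. c \<bullet> x)"
    and "\<And>a. a \<in> dd_arcs D \<Longrightarrow>
           arc_len D a = (if arc_val D a = 1 then c $ tail_layer D a else 0)"
    and "xL \<in> binary_vecs n"
    and "follower_system D xL xF y \<pi> \<gamma>"
    and "\<And>a. a \<in> dd_arcs D \<Longrightarrow> xL $ tail_layer D a = 1 \<Longrightarrow> arc_val D a = 1 \<Longrightarrow>
           M a \<ge> 0 \<and> M a \<ge> arc_len D a + \<pi> (arc_head D a) - \<pi> (arc_tail D a)"
  shows "\<exists>\<gamma>'. follower_system D xL xF y \<pi> \<gamma>' \<and>
           (\<forall>a \<in> dd_arcs D. xL $ tail_layer D a = 1 \<and> arc_val D a = 1 \<longrightarrow> \<gamma>' a = M a) \<and>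
           (\<forall>a \<in> dd_arcs D. \<not> (xL $ tail_layer D a = 1 \<and> arc_val D a = 1) \<longrightarrow> \<gamma>' a = \<gamma> a)"
proof -
  define \<gamma>' where
    "\<gamma>' a = (if xL $ tail_layer D a = 1 \<and> arc_val D a = 1 then M a else \<gamma> a)" for a
  have "follower_system D xL xF y \<pi> \<gamma>'"
  proof (rule follower_system_change_multipliers[OF assms(9)])
    fix a assume "a \<in> dd_arcs D" and "arc_val D a = 1" and "\<gamma>' a \<noteq> \<gamma> a"
    then show "xL $ tail_layer D a = 1 \<and> \<gamma>' a \<ge> 0 \<and>
        \<gamma>' a \<ge> arc_len D a + \<pi> (arc_head D a) - \<pi> (arc_tail D a)"
      using assms(10)[of a] by (auto simp: \<gamma>'_def split: if_splits)
  qed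
  then show ?thesis
    by (intro exI[of _ \<gamma>']) (simp add: \<gamma>'_def)
qed

end
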